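(* If $0\to M\to N\to P\to 0$ is a short exact sequence of finitely presented persistence modules, then $|N|=|M|+|P|$, where $|\cdot|$ denotes persistent magnitude.
   Context: Fix a field $\Bbbk$. A persistence module is a functor $(\mathbb{R},\le)\to\mathbf{Vect}_\Bbbk$; morphisms are natural transformations, and exactness is objectwise. The interval module $\Bbbk[a,b)$ ($-\infty<a<b\le\infty$) is $\Bbbk$ at points of $[a,b)$ and $0$ elsewhere, with identity structure maps between points of $[a,b)$. A persistence module is finitely presented if and only if it is isomorphic to a finite direct sum of interval modules $\Bbbk[a,b)$. The persistent magnitude of a finitely presented $M\cong\bigoplus_{i=1}^n\Bbbk[a_i,b_i)$ is $|M|=\sum_{i=1}^n(e^{-a_i}-e^{-b_i})$, with the convention $e^{-\infty}=0$. *)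

theory Defs
  imports
    "HOL-Library.Extended_Real"
    "Jordan_Normal_Form.Missing_VectorSpace"
begin

section \<open>Persistence modules\<close>

text \<open>
  A functor from the poset of the reals to vector spaces over \<open>K\<close>. The structure map \<open>pmap M s t\<close>
  is only meaningful for \<open>s \<le> t\<close>. As usual in HOL-Algebra, functions matter only on carriers, so
  all equations between linear maps are stated on carriers.
\<close>

record ('k, 'v) pmod =
  pspace :: "real \<Rightarrow> ('k, 'v) module"
  pmap :: "real \<Rightarrow> real \<Rightarrow> 'v \<Rightarrow> 'v"

locale persistence_module =
  fixes K :: "('k, 'r) ring_scheme" and M :: "('k, 'v) pmod"
  assumes space_vectorspace: "vectorspace K (pspace M t)"
    and map_linear: "s \<le> t \<Longrightarrow> linear_map K (pspace M s) (pspace M t) (pmap M s t)"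
    and map_id: "x \<in> carrier (pspace M t) \<Longrightarrow> pmap M t t x = x"
    and map_comp: "\<lbrakk>r \<le> s; s \<le> t; x \<in> carrier (pspace M r)\<rbrakk>
      \<Longrightarrow> pmap M s t (pmap M r s x) = pmap M r t x"

locale pmod_hom =
  M: persistence_module K M + N: persistence_module K N
  for K :: "('k, 'r) ring_scheme" and M :: "('k, 'v) pmod" and N :: "('k, 'w) pmod" +
  fixes f :: "real \<Rightarrow> 'v \<Rightarrow> 'w"
  assumes hom_linear: "linear_map K (pspace M t) (pspace N t) (f t)"
    and hom_natural: "\<lbrakk>s \<le> t; x \<in> carrier (pspace M s)\<rbrakk>
      \<Longrightarrow> f t (pmap M s t x) = pmap N s t (f s x)"

definition pmod_iso :: "('k, 'r) ring_scheme \<Rightarrow> ('k, 'v) pmod \<Rightarrow> ('k, 'w) pmod \<Rightarrow> bool" where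
  "pmod_iso K M N \<longleftrightarrow> (\<exists>f g. pmod_hom K M N f \<and> pmod_hom K N M g \<and>
     (\<forall>t. \<forall>x \<in> carrier (pspace M t). g t (f t x) = x) \<and>
     (\<forall>t. \<forall>y \<in> carrier (pspace N t). f t (g t y) = y))"

text \<open>
  The three equations are exactness at \<open>M\<close>, \<open>N\<close> and \<open>P\<close> of the sequence
  \<open>0 \<rightarrow> M \<rightarrow> N \<rightarrow> P \<rightarrow> 0\<close>, evaluated at each \<open>t\<close>.
\<close>

definition short_exact :: "('k, 'r) ring_scheme \<Rightarrow> ('k, 'u) pmod \<Rightarrow> ('k, 'v) pmod \<Rightarrow> ('k, 'w) pmod
    \<Rightarrow> (real \<Rightarrow> 'u \<Rightarrow> 'v) \<Rightarrow> (real \<Rightarrow> 'v \<Rightarrow> 'w) \<Rightarrow> bool" where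
  "short_exact K M N P f g \<longleftrightarrow> pmod_hom K M N f \<and> pmod_hom K N P g \<and>
     (\<forall>t. mod_hom.ker (pspace M t) (pspace N t) (f t) = {\<zero>\<^bsub>pspace M t\<^esub>} \<and>
          mod_hom.im (pspace M t) (f t) = mod_hom.ker (pspace N t) (pspace P t) (g t) \<and>
          mod_hom.im (pspace N t) (g t) = carrier (pspace P t))"


section \<open>Interval modules and finite direct sums\<close>

text \<open>The field \<open>K\<close> as a one-dimensional vector space over itself.\<close>

definition field_space :: "('k, 'r) ring_scheme \<Rightarrow> ('k, 'k) module" where
  "field_space K = \<lparr>carrier = carrier K, mult = mult K, one = \<one>\<^bsub>K\<^esub>, zero = \<zero>\<^bsub>K\<^esub>, add = add K,
     smult = mult K\<rparr>"

definition interval_module :: "('k, 'r) ring_scheme \<Rightarrow> real \<Rightarrow> ereal \<Rightarrow> ('k, 'k) pmod" where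
  "interval_module K a b =
     (let I = {t. a \<le> t \<and> ereal t < b} in
      \<lparr>pspace = (\<lambda>t. if t \<in> I then field_space K else (field_space K)\<lparr>carrier := {\<zero>\<^bsub>K\<^esub>}\<rparr>),
       pmap = (\<lambda>s t x. if s \<in> I \<and> t \<in> I then x else \<zero>\<^bsub>K\<^esub>)\<rparr>)"

text \<open>
  The direct sum of the \<open>D i\<close> with \<open>i < n\<close>, realised as tuples, that is, extensional functions on
  \<open>{..<n}\<close>. The fields \<open>mult\<close> and \<open>one\<close> of a module record are not part of the module structure.
\<close>

definition direct_sum_space :: "nat \<Rightarrow> (nat \<Rightarrow> ('k, 'v) module) \<Rightarrow> ('k, nat \<Rightarrow> 'v) module" where
  "direct_sum_space n V =
     \<lparr>carrier = (\<Pi>\<^sub>E i\<in>{..<n}. carrier (V i)),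
      mult = (\<lambda>f g. \<lambda>i\<in>{..<n}. \<zero>\<^bsub>V i\<^esub>),
      one = (\<lambda>i\<in>{..<n}. \<zero>\<^bsub>V i\<^esub>),
      zero = (\<lambda>i\<in>{..<n}. \<zero>\<^bsub>V i\<^esub>),
      add = (\<lambda>f g. \<lambda>i\<in>{..<n}. f i \<oplus>\<^bsub>V i\<^esub> g i),
      smult = (\<lambda>c f. \<lambda>i\<in>{..<n}. c \<odot>\<^bsub>V i\<^esub> f i)\<rparr>"

definition pmod_direct_sum :: "nat \<Rightarrow> (nat \<Rightarrow> ('k, 'v) pmod) \<Rightarrow> ('k, nat \<Rightarrow> 'v) pmod" where
  "pmod_direct_sum n D =
     \<lparr>pspace = (\<lambda>t. direct_sum_space n (\<lambda>i. pspace (D i) t)),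
      pmap = (\<lambda>s t f. \<lambda>i\<in>{..<n}. pmap (D i) s t (f i))\<rparr>"


section \<open>Finitely presented modules and persistent magnitude\<close>

definition interval_decomposition ::
    "('k, 'r) ring_scheme \<Rightarrow> ('k, 'v) pmod \<Rightarrow> nat \<Rightarrow> (nat \<Rightarrow> real) \<Rightarrow> (nat \<Rightarrow> ereal) \<Rightarrow> bool" where
  "interval_decomposition K M n a b \<longleftrightarrow>
     (\<forall>i<n. ereal (a i) < b i) \<and>
     pmod_iso K M (pmod_direct_sum n (\<lambda>i. interval_module K (a i) (b i)))"

text \<open>
  Finite presentation is taken in the form of its standard characterization: being isomorphic to a
  finite direct sum of interval modules.
\<close>

definition finitely_presented :: "('k, 'r) ring_scheme \<Rightarrow> ('k, 'v) pmod \<Rightarrow> bool" where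
  "finitely_presented K M \<longleftrightarrow> (\<exists>n a b. interval_decomposition K M n a b)"

definition exp_neg :: "ereal \<Rightarrow> real" where
  "exp_neg b = (if b = \<infinity> then 0 else exp (- real_of_ereal b))"

text \<open>
  The description denotes only because the sum is the same for all interval decompositions of \<open>M\<close>;
  this independence is a theorem and not built into the definition.
\<close>

definition persistent_magnitude :: "('k, 'r) ring_scheme \<Rightarrow> ('k, 'v) pmod \<Rightarrow> real" where
  "persistent_magnitude K M =
     (THE m. \<exists>n a b. interval_decomposition K M n a b \<and>
        m = (\<Sum>i<n. exp (- a i) - exp_neg (b i)))"


section \<open>Well-formedness of the constructions\<close>

lemma field_space_vectorspace:
  assumes "field K"
  shows "vectorspace K (field_space K)"
proof -
  interpret K: field K by fact
  have "abelian_group (field_space K)"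
    by (rule abelian_groupI; simp add: field_space_def)
      (simp_all add: K.a_ac K.add.l_inv_ex)
  then have "module K (field_space K)"
    by (rule moduleI[OF K.is_cring]; simp add: field_space_def)
      (simp_all add: K.m_assoc K.l_distr K.r_distr)
  then show ?thesis by (simp add: vectorspace_def assms)
qed

lemma zero_space_vectorspace:
  assumes "field K"
  shows "vectorspace K ((field_space K)\<lparr>carrier := {\<zero>\<^bsub>K\<^esub>}\<rparr>)"
proof -
  interpret K: field K by fact
  have "abelian_group ((field_space K)\<lparr>carrier := {\<zero>\<^bsub>K\<^esub>}\<rparr>)"
    by (rule abelian_groupI; simp add: field_space_def)
  then have "module K ((field_space K)\<lparr>carrier := {\<zero>\<^bsub>K\<^esub>}\<rparr>)"
    by (rule moduleI[OF K.is_cring]; simp add: field_space_def)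
  then show ?thesis by (simp add: vectorspace_def assms)
qed

lemma linear_mapI:
  assumes "vectorspace K V" "vectorspace K W" "f \<in> module_hom K V W"
  shows "linear_map K V W f"
  using assms by (simp add: linear_map_def mod_hom_def mod_hom_axioms_def vectorspace_def)

lemma interval_module_persistence_module:
  assumes "field K"
  shows "persistence_module K (interval_module K a b)"
proof -
  interpret K: field K by fact
  have vs: "vectorspace K (pspace (interval_module K a b) t)" for t
    by (simp add: interval_module_def Let_def field_space_vectorspace zero_space_vectorspace assms)
  show ?thesis
  proof (rule persistence_module.intro)
    fix s t :: real
    assume "s \<le> t"
    show "linear_map K (pspace (interval_module K a b) s) (pspace (interval_module K a b) t)
        (pmap (interval_module K a b) s t)"
      by (rule linear_mapI[OF vs vs])
        (auto simp: module_hom_def interval_module_def Let_def field_space_def)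
  next
    fix r s t :: real and x
    assume *: "r \<le> s" "s \<le> t" "x \<in> carrier (pspace (interval_module K a b) r)"
    have "ereal s < b" if "ereal t < b"
      using \<open>s \<le> t\<close> that by (meson ereal_less_eq(3) le_less_trans)
    with * show "pmap (interval_module K a b) s t (pmap (interval_module K a b) r s x) =
        pmap (interval_module K a b) r t x"
      by (auto simp: interval_module_def Let_def)
  qed (use vs in \<open>auto simp: interval_module_def Let_def split: if_splits\<close>)
qed

lemma direct_sum_space_vectorspace:
  assumes "field K" and "\<And>i. i < n \<Longrightarrow> vectorspace K (V i)"
  shows "vectorspace K (direct_sum_space n V)"
proof -
  interpret K: field K by fact
  have m: "module K (V i)" if "i < n" for i
    using assms(2)[OF that] by (simp add: vectorspace_def)
  note ag = module.axioms(2)[OF m]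
  note [simp] = abelian_groupE(1,2)[OF ag] abelian_groupE(5)[OF ag] module.smult_closed[OF m]
    module.smult_one[OF m]
  have "abelian_group (direct_sum_space n V)"
  proof (rule abelian_groupI, goal_cases)
    case (3 f g h)
    then show ?case
      by (auto simp: direct_sum_space_def PiE_iff abelian_groupE(3)[OF ag] intro!: restrict_ext)
  next
    case (4 f g)
    then show ?case
      by (auto simp: direct_sum_space_def PiE_iff intro!: restrict_ext abelian_groupE(4)[OF ag])
  next
    case (5 f)
    then show ?case
      by (auto simp: direct_sum_space_def PiE_iff fun_eq_iff restrict_def extensional_def)
  next
    case (6 f)
    then have "\<forall>i\<in>{..<n}. \<exists>y\<in>carrier (V i). y \<oplus>\<^bsub>V i\<^esub> f i = \<zero>\<^bsub>V i\<^esub>"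
      using abelian_groupE(6)[OF ag] by (auto simp: direct_sum_space_def PiE_iff)
    then obtain y where y: "\<And>i. i < n \<Longrightarrow> y i \<in> carrier (V i) \<and> y i \<oplus>\<^bsub>V i\<^esub> f i = \<zero>\<^bsub>V i\<^esub>"
      by (metis lessThan_iff)
    then show ?case
      by (intro bexI[of _ "restrict y {..<n}"])
        (auto simp: direct_sum_space_def intro!: restrict_ext)
  qed (auto simp: direct_sum_space_def PiE_iff)
  then have "module K (direct_sum_space n V)"
  proof (rule moduleI[OF K.is_cring], goal_cases)
    case (5 f)
    then show ?case
      by (auto simp: direct_sum_space_def PiE_iff fun_eq_iff restrict_def extensional_def)
  qed (auto simp: direct_sum_space_def PiE_iff module.smult_l_distr[OF m]
      module.smult_r_distr[OF m] module.smult_assoc1[OF m] intro!: restrict_ext)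
  then show ?thesis by (simp add: vectorspace_def assms)
qed

lemma pmod_direct_sum_persistence_module:
  assumes "field K" and "\<And>i. i < n \<Longrightarrow> persistence_module K (D i)"
  shows "persistence_module K (pmod_direct_sum n D)"
proof -
  have vs: "vectorspace K (pspace (pmod_direct_sum n D) t)" for t
    by (simp add: pmod_direct_sum_def direct_sum_space_vectorspace assms
        persistence_module.space_vectorspace)
  show ?thesis
  proof (rule persistence_module.intro)
    fix s t :: real
    assume st: "s \<le> t"
    have hom: "pmap (D i) s t \<in> module_hom K (pspace (D i) s) (pspace (D i) t)" if "i < n" for i
      using persistence_module.map_linear[OF assms(2)[OF that] st]
      by (simp add: linear_map_def mod_hom_def mod_hom_axioms_def)
    have closed: "pmap (D i) s t x \<in> carrier (pspace (D i) t)"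
      if "i < n" "x \<in> carrier (pspace (D i) s)" for i x
      using module_hom_closed[OF hom[OF that(1)]] that(2) by blast
    show "linear_map K (pspace (pmod_direct_sum n D) s) (pspace (pmod_direct_sum n D) t)
        (pmap (pmod_direct_sum n D) s t)"
      by (rule linear_mapI[OF vs vs], simp add: module_hom_def)
        (auto simp: pmod_direct_sum_def direct_sum_space_def PiE_iff closed
          module_hom_add[OF hom] module_hom_smult[OF hom] intro!: restrict_ext)
  next
    fix t f
    assume "f \<in> carrier (pspace (pmod_direct_sum n D) t)"
    then show "pmap (pmod_direct_sum n D) t t f = f"
      by (auto simp: pmod_direct_sum_def direct_sum_space_def PiE_iff fun_eq_iff restrict_def
          extensional_def persistence_module.map_id[OF assms(2)])
  next
    fix r s t :: real and f
    assume "r \<le> s" "s \<le> t" "f \<in> carrier (pspace (pmod_direct_sum n D) r)"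
    then show "pmap (pmod_direct_sum n D) s t (pmap (pmod_direct_sum n D) r s f) =
        pmap (pmod_direct_sum n D) r t f"
      by (auto simp: pmod_direct_sum_def direct_sum_space_def PiE_iff
          persistence_module.map_comp[OF assms(2)] intro!: restrict_ext)
  qed (rule vs)
qed

end

theory Submission
  imports "HOL-Analysis.Henstock_Kurzweil_Integration" Defs
begin

text \<open>
  Since \<open>exp (- a) - exp (- b)\<close> is the integral of \<open>exp (- t)\<close> over \<open>[a, b)\<close>, the sum attached to an
  interval decomposition of \<open>M\<close> is the integral of \<open>exp (- t) * dim (M t)\<close> over the real line. It is
  therefore independent of the decomposition, and it is additive on short exact sequences because
  the dimension is, by rank-nullity.
\<close>

text \<open>The value at a real \<open>t\<close> of a direct sum of \<open>n\<close> interval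
  modules, with \<open>S\<close> the set of indices whose interval contains \<open>t\<close>. All
  \<open>n\<close> coordinates are kept, with a zero space off \<open>S\<close>, so that this value
  equals \<open>free_on K n S\<close> as a record and not only up to isomorphism.\<close>

definition free_on :: "('k, 'r) ring_scheme \<Rightarrow> nat \<Rightarrow> nat set \<Rightarrow> ('k, nat \<Rightarrow> 'k) module" where
  "free_on K n S = direct_sum_space n
     (\<lambda>i. if i \<in> S then field_space K else (field_space K)\<lparr>carrier := {\<zero>\<^bsub>K\<^esub>}\<rparr>)"

lemma free_on_vectorspace:
  assumes "field K"
  shows "vectorspace K (free_on K n S)"
  unfolding free_on_def
  by (rule direct_sum_space_vectorspace)
    (simp_all add: assms field_space_vectorspace zero_space_vectorspace)

lemma free_on_simps:
  "carrier (free_on K n S) = (\<Pi>\<^sub>E i\<in>{..<n}. if i \<in> S then carrier K else {\<zero>\<^bsub>K\<^esub>})"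
  "zero (free_on K n S) = (\<lambda>i\<in>{..<n}. \<zero>\<^bsub>K\<^esub>)"
  "add (free_on K n S) x y = (\<lambda>i\<in>{..<n}. x i \<oplus>\<^bsub>K\<^esub> y i)"
  "smult (free_on K n S) c x = (\<lambda>i\<in>{..<n}. c \<otimes>\<^bsub>K\<^esub> x i)"
  by (simp_all add: free_on_def direct_sum_space_def field_space_def if_distrib cong: if_cong)

definition unit_tuple :: "('k, 'r) ring_scheme \<Rightarrow> nat \<Rightarrow> nat \<Rightarrow> nat \<Rightarrow> 'k" where
  "unit_tuple K n i = (\<lambda>j\<in>{..<n}. if j = i then \<one>\<^bsub>K\<^esub> else \<zero>\<^bsub>K\<^esub>)"

lemma unit_tuple_inj_on:
  assumes "field K"
  shows "inj_on (unit_tuple K n) {..<n}"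
proof (rule inj_onI)
  interpret K: field K by fact
  fix i j assume i: "i \<in> {..<n}" and "unit_tuple K n i = unit_tuple K n j"
  then have "unit_tuple K n i i = unit_tuple K n j i"
    by simp
  with i show "i = j"
    by (simp add: unit_tuple_def split: if_splits)
qed

lemma unit_tuple_closed:
  assumes "field K" and "i \<in> S"
  shows "unit_tuple K n i \<in> carrier (free_on K n S)"
proof -
  interpret K: field K by fact
  show ?thesis
    using assms(2) by (auto simp: free_on_simps unit_tuple_def restrict_PiE_iff)
qed

text \<open>Only the case \<open>A = S\<close> is used later; a general \<open>A\<close> lets the
  induction run over the index set while the ambient space stays fixed.\<close>

lemma lincomb_unit_tuples:
  assumes "field K" and S: "S \<subseteq> {..<n}" and "A \<subseteq> S"
    and c: "c \<in> unit_tuple K n ` A \<rightarrow> carrier K"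
  shows "module.lincomb (free_on K n S) c (unit_tuple K n ` A) =
    (\<lambda>j\<in>{..<n}. if j \<in> A then c (unit_tuple K n j) else \<zero>\<^bsub>K\<^esub>)"
proof -
  interpret K: field K by fact
  interpret X: vectorspace K "free_on K n S" by (rule free_on_vectorspace) fact
  have "finite A"
    using S \<open>A \<subseteq> S\<close> by (meson finite_lessThan finite_subset)
  then show ?thesis using \<open>A \<subseteq> S\<close> c
  proof (induction A)
    case empty
    then show ?case by (simp add: X.lincomb_def free_on_simps)
  next
    case (insert i A)
    let ?e = "unit_tuple K n"
    have sub: "insert i A \<subseteq> {..<n}"
      using insert.prems S by blast
    have e: "?e j \<in> carrier (free_on K n S)" if "j \<in> insert i A" for j
      using that insert.prems unit_tuple_closed[OF assms(1)] by blast
    have new: "?e i \<notin> ?e ` A"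
      using unit_tuple_inj_on[OF assms(1), of n] sub insert.hyps
      by (auto simp: inj_on_def)
    have ce: "c (?e j) \<in> carrier K" if "j \<in> insert i A" for j
      using that insert.prems by auto
    have "X.lincomb c (?e ` insert i A) = c (?e i) \<odot>\<^bsub>free_on K n S\<^esub> ?e i \<oplus>\<^bsub>free_on K n S\<^esub>
        X.lincomb c (?e ` A)"
      unfolding X.lincomb_def image_insert using new e ce insert.hyps
      by (intro X.finsum_insert) (auto intro: X.smult_closed)
    also have "X.lincomb c (?e ` A) = (\<lambda>j\<in>{..<n}. if j \<in> A then c (?e j) else \<zero>\<^bsub>K\<^esub>)"
      using insert.IH insert.prems by auto
    finally show ?case
      using insert.hyps ce by (auto simp: free_on_simps unit_tuple_def fun_eq_iff restrict_def)
  qed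
qed

text \<open>The unit tuples with index in \<open>S\<close> form a basis: the coordinates of a linear
  combination of them are its coefficients, which gives both spanning and independence.\<close>

lemma dim_free_on:
  assumes "field K" and S: "S \<subseteq> {..<n}"
  shows "vectorspace.fin_dim K (free_on K n S)"
    and "vectorspace.dim K (free_on K n S) = card S"
proof -
  interpret K: field K by fact
  interpret X: vectorspace K "free_on K n S" by (rule free_on_vectorspace) fact
  let ?e = "unit_tuple K n"
  note lc = lincomb_unit_tuples[OF assms order_refl]
  have inj: "inj_on ?e S"
    using unit_tuple_inj_on[OF assms(1)] S inj_on_subset by blast
  have fin: "finite (?e ` S)"
    using S finite_subset by blast
  have carr: "?e ` S \<subseteq> carrier (free_on K n S)"
    using unit_tuple_closed[OF assms(1)] by blast
  have "X.gen_set (?e ` S)"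
  proof
    show "X.span (?e ` S) \<subseteq> carrier (free_on K n S)"
      by (rule X.span_is_subset2[OF carr])
    show "carrier (free_on K n S) \<subseteq> X.span (?e ` S)"
    proof
      fix x assume x: "x \<in> carrier (free_on K n S)"
      \<comment> \<open>Coefficients are functions of vectors rather than of indices, so the index
        of a unit tuple has to be recovered by inverting \<open>?e\<close> on
        \<open>S\<close>.\<close>
      define c where "c v = x (inv_into S ?e v)" for v
      have ce: "c (?e i) = x i" if "i \<in> S" for i
        by (simp add: c_def inv_into_f_f[OF inj that])
      note mem = PiE_mem[OF x[unfolded free_on_simps]]
      have "x i \<in> carrier K" if "i \<in> S" for i
        using mem[of i] S that by auto
      then have c: "c \<in> ?e ` S \<rightarrow> carrier K"
        by (auto simp: ce)
      have "x j = \<zero>\<^bsub>K\<^esub>" if "j < n" "j \<notin> S" for j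
        using mem[of j] that by auto
      moreover have "x j = undefined" if "\<not> j < n" for j
        using x that by (auto simp: free_on_simps PiE_def extensional_def)
      ultimately have "X.lincomb c (?e ` S) = x"
        unfolding lc[OF c] by (intro ext) (auto simp: ce)
      then show "x \<in> X.span (?e ` S)"
        using c fin unfolding X.span_def by blast
    qed
  qed
  moreover have "X.lin_indpt (?e ` S)"
  proof (rule X.finite_lin_indpt2[OF fin carr], rule ballI)
    fix c v
    assume c: "c \<in> ?e ` S \<rightarrow> carrier K" and 0: "X.lincomb c (?e ` S) = \<zero>\<^bsub>free_on K n S\<^esub>"
      and "v \<in> ?e ` S"
    then obtain i where i: "i \<in> S" "v = ?e i" by blast
    with S have "i < n" by auto
    then show "c v = \<zero>\<^bsub>K\<^esub>"
      using fun_cong[OF 0, of i] i by (simp add: lc[OF c] free_on_simps)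
  qed
  ultimately show "X.fin_dim" "X.dim = card S"
    using fin carr X.dim_basis[of "?e ` S"] card_image[OF inj]
    by (auto simp: X.fin_dim_def X.basis_def)
qed

text \<open>Rank-nullity for \<open>T\<close> splits \<open>dim V\<close> into the dimensions of its
  image, which is \<open>W\<close>, and of its kernel. By exactness the kernel is the image of
  \<open>S\<close>, which is a copy of \<open>U\<close> since \<open>S\<close> is injective.\<close>

lemma exact_dim_add:
  assumes S: "linear_map K U V S" and T: "linear_map K V W T"
    and inj: "mod_hom.ker U V S = {\<zero>\<^bsub>U\<^esub>}"
    and exact: "mod_hom.im U S = mod_hom.ker V W T"
    and surj: "mod_hom.im V T = carrier W"
    and fd: "vectorspace.fin_dim K U" "vectorspace.fin_dim K V"
  shows "vectorspace.dim K V = vectorspace.dim K U + vectorspace.dim K W"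
proof -
  interpret S: linear_map K U V S by fact
  interpret T: linear_map K V W T by fact
  have "subspace K S.im V"
    by (rule S.imT_is_subspace)
  then have vs: "vectorspace K (V\<lparr>carrier := S.im\<rparr>)"
    by (rule S.W.subspace_is_vs)
  \<comment> \<open>Shrinking the codomain to the image turns \<open>S\<close> into a linear
    bijection, to which \<open>linear_map.dim_eq\<close> applies.\<close>
  have "linear_map K U (V\<lparr>carrier := S.im\<rparr>) S"
    by (rule linear_mapI[OF S.V.vectorspace_axioms vs])
      (auto simp: module_hom_def S.im_def)
  moreover have "inj_on S (carrier U)"
    using inj by (intro S.Ke0_imp_inj) simp
  ultimately have "vectorspace.dim K U = vectorspace.dim K (V\<lparr>carrier := S.im\<rparr>)"
    using fd(1) by (intro linear_map.dim_eq) (auto simp: S.im_def)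
  then show ?thesis
    using T.rank_nullity[OF fd(2)] by (simp add: exact surj)
qed

definition pdim :: "('k, 'r) ring_scheme \<Rightarrow> ('k, 'v) pmod \<Rightarrow> real \<Rightarrow> nat" where
  "pdim K M t = vectorspace.dim K (pspace M t)"

text \<open>The bijection points from \<open>N\<close> to \<open>M\<close> because finite
  dimensionality is transported from domain to codomain, and in the application \<open>N\<close> is
  the explicit direct sum.\<close>

lemma pmod_iso_linear_bij:
  assumes "pmod_iso K M N"
  obtains h where "linear_map K (pspace N t) (pspace M t) h"
    "inj_on h (carrier (pspace N t))" "h ` carrier (pspace N t) = carrier (pspace M t)"
proof -
  obtain f g where f: "pmod_hom K M N f" and g: "pmod_hom K N M g"
    and gf: "\<And>x. x \<in> carrier (pspace M t) \<Longrightarrow> g t (f t x) = x"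
    and fg: "\<And>y. y \<in> carrier (pspace N t) \<Longrightarrow> f t (g t y) = y"
    using assms unfolding pmod_iso_def by blast
  interpret F: linear_map K "pspace M t" "pspace N t" "f t"
    by (rule pmod_hom.hom_linear[OF f])
  interpret G: linear_map K "pspace N t" "pspace M t" "g t"
    by (rule pmod_hom.hom_linear[OF g])
  have "bij_betw (g t) (carrier (pspace N t)) (carrier (pspace M t))"
    by (rule bij_betw_byWitness[where f' = "f t"]) (auto simp: gf fg)
  then show ?thesis
    using that[OF G.linear_map_axioms] by (simp add: bij_betw_def)
qed

lemma interval_decomposition_dim:
  assumes "field K" and dec: "interval_decomposition K M n a b"
  shows "vectorspace.fin_dim K (pspace M t)"
    and "pdim K M t = card {i. i < n \<and> a i \<le> t \<and> ereal t < b i}"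
proof -
  let ?N = "pmod_direct_sum n (\<lambda>i. interval_module K (a i) (b i))"
  let ?S = "{i. i < n \<and> a i \<le> t \<and> ereal t < b i}"
  have N: "pspace ?N t = free_on K n ?S"
    by (auto simp: pmod_direct_sum_def free_on_def direct_sum_space_def interval_module_def Let_def
        field_space_def fun_eq_iff PiE_def Pi_def split: if_splits intro!: restrict_ext)
  note dim = dim_free_on[OF assms(1), of ?S n]
  obtain h where lin: "linear_map K (free_on K n ?S) (pspace M t) h"
    and h: "inj_on h (carrier (free_on K n ?S))"
      "h ` carrier (free_on K n ?S) = carrier (pspace M t)"
    using dec pmod_iso_linear_bij[of K M ?N t] unfolding interval_decomposition_def N by blast
  interpret H: linear_map K "free_on K n ?S" "pspace M t" h by fact
  show "H.W.fin_dim"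
    using H.surj_fin_dim h dim(1) by auto
  show "pdim K M t = card ?S"
    using H.dim_eq[OF _ h] dim by (auto simp: pdim_def)
qed

lemma exp_neg_has_integral:
  assumes "ereal a < b"
  shows "((\<lambda>t. if a \<le> t \<and> ereal t < b then exp (- t) else 0) has_integral
    exp (- a) - exp_neg b) UNIV"
proof -
  have tail: "((\<lambda>t. if c \<le> t then exp (- t) else 0) has_integral exp (- c)) UNIV" for c :: real
    using has_integral_exp_minus_to_infinity[of 1 c]
      has_integral_restrict_UNIV[of "{c..}" "\<lambda>t. exp (- t)" "exp (- c)"] by simp
  show ?thesis
  proof (cases b)
    case (real c)
    \<comment> \<open>As \<open>a < c\<close>, the indicator of \<open>[a, c)\<close> is that of
      \<open>[a, \<infinity>)\<close> minus that of \<open>[c, \<infinity>)\<close>.\<close>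
    with assms have eq: "(\<lambda>t. if a \<le> t \<and> ereal t < b then exp (- t) else 0) =
      (\<lambda>t. (if a \<le> t then exp (- t) else 0) - (if c \<le> t then exp (- t) else 0))"
      by auto
    show ?thesis
      unfolding eq using has_integral_diff[OF tail tail, of a c] by (simp add: real exp_neg_def)
  \<comment> \<open>For \<open>b = \<infinity>\<close> the first half-line is the whole interval and
    \<open>exp_neg b\<close> is 0; \<open>b = -\<infinity>\<close> contradicts
    \<open>ereal a < b\<close>.\<close>
  qed (use assms tail[of a] in \<open>auto simp: exp_neg_def\<close>)
qed

text \<open>The dimension at \<open>t\<close> counts the intervals containing \<open>t\<close>, so
  it is a finite sum of indicators and can be integrated term by term.\<close>

lemma interval_decomposition_has_integral:
  assumes "field K" and dec: "interval_decomposition K M n a b"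
  shows "((\<lambda>t. exp (- t) * pdim K M t) has_integral (\<Sum>i<n. exp (- a i) - exp_neg (b i))) UNIV"
proof -
  have "exp (- t) * pdim K M t = (\<Sum>i<n. if a i \<le> t \<and> ereal t < b i then exp (- t) else 0)" for t
  proof -
    have "{..<n} \<inter> {i. a i \<le> t \<and> ereal t < b i} = {i. i < n \<and> a i \<le> t \<and> ereal t < b i}"
      by auto
    then show ?thesis
      by (simp add: interval_decomposition_dim(2)[OF assms] sum.If_cases)
  qed
  moreover have "((\<lambda>t. \<Sum>i<n. if a i \<le> t \<and> ereal t < b i then exp (- t) else 0) has_integral
      (\<Sum>i<n. exp (- a i) - exp_neg (b i))) UNIV"
    using dec by (intro has_integral_sum exp_neg_has_integral)
      (auto simp: interval_decomposition_def)
  ultimately show ?thesis by simp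
qed

text \<open>The integrand mentions no decomposition, so uniqueness of integrals forces all
  decompositions to give the same sum. This makes the description in
  \<open>persistent_magnitude\<close> denote, without comparing the intervals themselves.\<close>

lemma persistent_magnitude_has_integral:
  assumes "field K" and "finitely_presented K M"
  shows "((\<lambda>t. exp (- t) * pdim K M t) has_integral persistent_magnitude K M) UNIV"
proof -
  obtain n a b where dec: "interval_decomposition K M n a b"
    using assms(2) unfolding finitely_presented_def by blast
  have "persistent_magnitude K M = (\<Sum>i<n. exp (- a i) - exp_neg (b i))"
    unfolding persistent_magnitude_def
  proof (rule the_equality)
    fix m assume "\<exists>n a b. interval_decomposition K M n a b \<and>
        m = (\<Sum>i<n. exp (- a i) - exp_neg (b i))"
    then show "m = (\<Sum>i<n. exp (- a i) - exp_neg (b i))"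
      using interval_decomposition_has_integral[OF assms(1)] dec has_integral_unique by blast
  qed (use dec in blast)
  then show ?thesis
    using interval_decomposition_has_integral[OF assms(1) dec] by simp
qed

theorem proposition5p3:
  fixes K :: "('k, 'r) ring_scheme"
    and M :: "('k, 'u) pmod" and N :: "('k, 'v) pmod" and P :: "('k, 'w) pmod"
    and f :: "real \<Rightarrow> 'u \<Rightarrow> 'v" and g :: "real \<Rightarrow> 'v \<Rightarrow> 'w"
  assumes "field K"
    and "finitely_presented K M" and "finitely_presented K N" and "finitely_presented K P"
    and "short_exact K M N P f g"
  shows "persistent_magnitude K N = persistent_magnitude K M + persistent_magnitude K P"
proof -
  have fd: "vectorspace.fin_dim K (pspace M t)" "vectorspace.fin_dim K (pspace N t)" for t
    using assms(2,3) interval_decomposition_dim(1)[OF assms(1)]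
    unfolding finitely_presented_def by blast+
  \<comment> \<open>Exactness is objectwise, so the dimension count for vector spaces applies at
    each \<open>t\<close> separately.\<close>
  have dim: "pdim K N t = pdim K M t + pdim K P t" for t
    unfolding pdim_def
    by (rule exact_dim_add[of K _ _ "f t" _ "g t"])
      (use assms(5) fd in \<open>auto simp: short_exact_def pmod_hom.hom_linear\<close>)
  have "((\<lambda>t. exp (- t) * pdim K N t) has_integral
      persistent_magnitude K M + persistent_magnitude K P) UNIV"
    using has_integral_add[OF persistent_magnitude_has_integral[OF assms(1,2)]
        persistent_magnitude_has_integral[OF assms(1,4)]]
    by (simp add: dim distrib_left)
  then show ?thesis
    using persistent_magnitude_has_integral[OF assms(1,3)] has_integral_unique by blast
qed

end
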